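(* Let $L$ be a complete atomistic lattice and let $T$ be a t-norm on the bounded poset $C(L)=A(L)\cup\{0,1\}$. Then the binary operation $\overline{T}$ on $L$ defined by $$\overline{T}(x,y)=\bigvee_{u\in\kappa(x)}\ \bigvee_{v\in\kappa(y)}T(u,v),\qquad \kappa(x)=\{u\in C(L)\setminus\{0\}\mid u\le x\},$$ is a t-norm on $L$.
   Context: A lattice $L$ with bottom $0$ and top $1$ is atomistic if every element is the join of some set of atoms (elements covering $0$); $A(L)$ is the set of atoms. $C(L)=A(L)\cup\{0,1\}$ carries the order inherited from $L$. A t-norm on a bounded poset $P$ with top $1$ is a binary operation that is monotone in each argument, commutative, associative and has neutral element $1$. *)

theory Defs
  imports Main
begin

definition atoms :: "'a::order_bot set" where
  "atoms = {a. bot < a \<and> (\<nexists>z. bot < z \<and> z < a)}"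

definition atomistic :: "'a::complete_lattice itself \<Rightarrow> bool" where
  "atomistic _ \<longleftrightarrow> (\<forall>x::'a. \<exists>S \<subseteq> atoms. x = Sup S)"

definition CL :: "'a::{order_bot,order_top} set" where
  "CL = atoms \<union> {bot, top}"

(* A bounded subposet P of a bounded order is given by a carrier set containing the
   ambient bottom and top; its order is the restricted one. A binary operation on P is a
   function on the whole type mapping P x P into P; its values outside P are irrelevant. *)
definition tnorm_on :: "'a::{order_bot,order_top} set \<Rightarrow> ('a \<Rightarrow> 'a \<Rightarrow> 'a) \<Rightarrow> bool" where
  "tnorm_on P T \<longleftrightarrow>
     bot \<in> P \<and> top \<in> P \<and>
     (\<forall>x\<in>P. \<forall>y\<in>P. T x y \<in> P) \<and>
     (\<forall>x\<in>P. \<forall>y\<in>P. \<forall>z\<in>P. x \<le> y \<longrightarrow> T x z \<le> T y z) \<and>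
     (\<forall>x\<in>P. \<forall>y\<in>P. \<forall>z\<in>P. x \<le> y \<longrightarrow> T z x \<le> T z y) \<and>
     (\<forall>x\<in>P. \<forall>y\<in>P. T x y = T y x) \<and>
     (\<forall>x\<in>P. \<forall>y\<in>P. \<forall>z\<in>P. T (T x y) z = T x (T y z)) \<and>
     (\<forall>x\<in>P. T x top = x \<and> T top x = x)"

definition kappa :: "'a::{order_bot,order_top} \<Rightarrow> 'a set" where
  "kappa x = {u \<in> CL - {bot}. u \<le> x}"

definition Tbar :: "('a::complete_lattice \<Rightarrow> 'a \<Rightarrow> 'a) \<Rightarrow> 'a \<Rightarrow> 'a \<Rightarrow> 'a" where
  "Tbar T x y = (SUP u\<in>kappa x. SUP v\<in>kappa y. T u v)"

end

theory Submission
  imports Defs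
begin

text \<open>
  For atoms \<open>u\<close> and \<open>v\<close> the element \<open>T u v\<close> lies below both, so it is \<open>\<bottom>\<close> unless \<open>u = v\<close> and
  \<open>T u u = u\<close>. Hence, for \<open>x\<close> and \<open>y\<close> different from the top element, \<open>Tbar T x y\<close> is the join of
  the \<open>T\<close>-idempotent atoms below both \<open>x\<close> and \<open>y\<close>. As \<open>Tbar T x y\<close> is itself below \<open>x\<close> and \<open>y\<close>,
  no further idempotent atoms appear below it, which gives associativity.
\<close>

lemma atom_le_cases:
  assumes "a \<in> atoms" "z \<le> a"
  shows "z = bot \<or> z = a"
  using assms unfolding atoms_def by (metis (mono_tags, lifting) bot.not_eq_extremum mem_Collect_eq order_le_less)

text \<open>Any set of atoms whose join is \<open>x\<close> lies inside \<open>kappa x\<close>, and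
  \<open>kappa x\<close> is bounded by \<open>x\<close>.\<close>

lemma Sup_kappa_atomistic:
  fixes x :: "'a::complete_lattice"
  assumes "atomistic TYPE('a)"
  shows "Sup (kappa x) = x"
proof (rule antisym)
  show "Sup (kappa x) \<le> x"
    by (auto simp: kappa_def intro: Sup_least)
  obtain S where S: "S \<subseteq> atoms" "x = Sup S"
    using assms unfolding atomistic_def by blast
  then have "S \<subseteq> kappa x"
    by (auto simp: kappa_def CL_def atoms_def intro: Sup_upper)
  then show "x \<le> Sup (kappa x)"
    using S(2) by (simp add: Sup_subset_mono)
qed

lemma kappa_mono: "x \<le> y \<Longrightarrow> kappa x \<subseteq> kappa y"
  by (auto simp: kappa_def intro: order_trans)

lemma kappa_subset_CL: "kappa x \<subseteq> CL"
  by (auto simp: kappa_def)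

text \<open>The only possible non-atom in \<open>kappa x\<close> is \<open>top\<close>, and it lies
  below \<open>x\<close> only if \<open>x = top\<close>; hence the separate treatment of
  \<open>top\<close> below.\<close>

lemma kappa_eq_atoms:
  assumes "x \<noteq> top"
  shows "kappa x = {a \<in> atoms. a \<le> x}"
  using assms by (auto simp: kappa_def CL_def atoms_def top.extremum_unique)

lemma Tbar_mono:
  assumes "x \<le> x'" "y \<le> y'"
  shows "Tbar T x y \<le> Tbar T x' y'"
  unfolding Tbar_def using assms by (intro SUP_subset_mono kappa_mono order_refl)

text \<open>The two bounds come from monotonicity and neutrality: \<open>T u v\<close> is at most
  \<open>T u top = u\<close>, and likewise at most \<open>T top v = v\<close>.\<close>

lemma tnorm_on_CL:
  assumes "tnorm_on CL T"
  shows tnorm_on_CL_commute: "\<lbrakk>u \<in> CL; v \<in> CL\<rbrakk> \<Longrightarrow> T u v = T v u"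
    and tnorm_on_CL_le1: "\<lbrakk>u \<in> CL; v \<in> CL\<rbrakk> \<Longrightarrow> T u v \<le> u"
    and tnorm_on_CL_le2: "\<lbrakk>u \<in> CL; v \<in> CL\<rbrakk> \<Longrightarrow> T u v \<le> v"
    and tnorm_on_CL_top: "u \<in> CL \<Longrightarrow> T u top = u"
  using assms unfolding tnorm_on_def by (metis top_greatest)+

lemma Tbar_commute:
  assumes "tnorm_on CL T"
  shows "Tbar T x y = Tbar T y x"
proof -
  have "Tbar T x y = (SUP v\<in>kappa y. SUP u\<in>kappa x. T u v)"
    unfolding Tbar_def by (rule SUP_commute)
  also have "\<dots> = Tbar T y x"
    unfolding Tbar_def
    using kappa_subset_CL tnorm_on_CL_commute[OF assms]
    by (intro SUP_cong refl) blast
  finally show ?thesis .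
qed

lemma Tbar_top:
  fixes x :: "'a::complete_lattice"
  assumes "atomistic TYPE('a)" "tnorm_on CL T"
  shows "Tbar T x top = x"
proof (rule antisym)
  have "Tbar T x top \<le> Sup (kappa x)"
    unfolding Tbar_def
  proof (intro SUP_least)
    fix u v assume uv: "u \<in> kappa x" "v \<in> kappa (top::'a)"
    then have "T u v \<le> u"
      using kappa_subset_CL tnorm_on_CL_le1[OF assms(2)] by blast
    then show "T u v \<le> Sup (kappa x)"
      using uv(1) by (rule Sup_upper2[rotated])
  qed
  then show "Tbar T x top \<le> x"
    using Sup_kappa_atomistic[OF assms(1), of x] by simp
  have "u \<le> Tbar T x top" if u: "u \<in> kappa x" for u
  proof -
    \<comment> \<open>Membership requires \<open>top\<close> to differ from \<open>bot\<close>. The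
      nonzero element \<open>u\<close> guarantees this; in the one-element lattice
      \<open>kappa\<close> is empty.\<close>
    have "(top::'a) \<in> kappa top"
      using u by (auto simp: kappa_def CL_def) (metis bot_unique top_greatest)
    moreover have "T u top = u"
      using u kappa_subset_CL tnorm_on_CL_top[OF assms(2)] by blast
    ultimately show ?thesis
      unfolding Tbar_def using u by (metis SUP_upper SUP_upper2)
  qed
  then have "Sup (kappa x) \<le> Tbar T x top"
    by (rule Sup_least)
  then show "x \<le> Tbar T x top"
    using Sup_kappa_atomistic[OF assms(1), of x] by simp
qed

lemma Tbar_eq_Sup_idempotent_atoms:
  assumes T: "tnorm_on CL T" and "x \<noteq> top" "y \<noteq> top"
  shows "Tbar T x y = Sup {a \<in> atoms. T a a = a \<and> a \<le> x \<and> a \<le> y}" (is "_ = Sup ?D")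
proof (rule antisym)
  show "Tbar T x y \<le> Sup ?D"
    unfolding Tbar_def
  proof (intro SUP_least)
    fix u v assume "u \<in> kappa x" "v \<in> kappa y"
    then have u: "u \<in> atoms" "u \<le> x" and v: "v \<in> atoms" "v \<le> y"
      using assms kappa_eq_atoms by auto
    then have "T u v \<le> u" "T u v \<le> v"
      using tnorm_on_CL_le1[OF T] tnorm_on_CL_le2[OF T] by (auto simp: CL_def)
    then consider "T u v = bot" | "T u v = u" "u = v"
      using u(1) v(1) by (metis atom_le_cases)
    then show "T u v \<le> Sup ?D"
    proof cases
      case 2
      then have "u \<in> ?D" using u v by auto
      then show ?thesis using 2 by (metis (no_types, lifting) Sup_upper)
    qed simp
  qed
  \<comment> \<open>An idempotent atom \<open>a\<close> below both arguments is itself the term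
    \<open>T a a\<close> of the double join.\<close>
  show "Sup ?D \<le> Tbar T x y"
  proof (rule Sup_least)
    fix a assume "a \<in> ?D"
    then have "a \<in> kappa x" "a \<in> kappa y" "T a a = a"
      using assms kappa_eq_atoms by auto
    then show "a \<le> Tbar T x y"
      unfolding Tbar_def by (metis SUP_upper SUP_upper2)
  qed
qed

lemma Tbar_Tbar_eq_Sup_idempotent_atoms:
  assumes "tnorm_on CL T" "x \<noteq> top" "y \<noteq> top" "z \<noteq> top"
  shows "Tbar T (Tbar T x y) z = Sup {a \<in> atoms. T a a = a \<and> a \<le> x \<and> a \<le> y \<and> a \<le> z}"
proof -
  let ?w = "Tbar T x y"
  have w: "?w = Sup {a \<in> atoms. T a a = a \<and> a \<le> x \<and> a \<le> y}"
    by (rule Tbar_eq_Sup_idempotent_atoms[OF assms(1-3)])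
  then have le: "?w \<le> x" "?w \<le> y"
    by (auto intro: Sup_least)
  \<comment> \<open>This allows the formula for \<open>Tbar\<close> to be applied again, with
    \<open>?w\<close> as first argument.\<close>
  then have "?w \<noteq> top"
    using assms(2) by (auto simp: top_unique)
  \<comment> \<open>No primeness of atoms is involved: from left to right \<open>?w\<close> is below
    \<open>x\<close> and \<open>y\<close>, and from right to left \<open>a\<close> is one of the
    elements joined to form \<open>?w\<close>.\<close>
  moreover have "a \<le> ?w \<longleftrightarrow> a \<le> x \<and> a \<le> y" if "a \<in> atoms" "T a a = a" for a
    using that le order_trans by (auto simp: w intro: Sup_upper)
  ultimately show ?thesis
    using Tbar_eq_Sup_idempotent_atoms[OF assms(1) _ assms(4), of ?w]
    by (auto intro!: arg_cong[where f = Sup])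
qed

lemma Tbar_assoc:
  fixes x y z :: "'a::complete_lattice"
  assumes "atomistic TYPE('a)" and T: "tnorm_on CL T"
  shows "Tbar T (Tbar T x y) z = Tbar T x (Tbar T y z)"
proof (cases "x = top \<or> y = top \<or> z = top")
  \<comment> \<open>By neutrality and commutativity, both sides reduce to \<open>Tbar T\<close> of
    the two remaining arguments.\<close>
  case True
  then show ?thesis
    using Tbar_top[OF assms] Tbar_commute[OF T] by metis
next
  case False
  \<comment> \<open>With both brackets on the left, the two sides are joins of sets whose defining
    conditions differ only in the order of the conjuncts.\<close>
  have "Tbar T x (Tbar T y z) = Tbar T (Tbar T y z) x"
    by (rule Tbar_commute[OF T])
  then show ?thesis
    using False by (simp add: Tbar_Tbar_eq_Sup_idempotent_atoms[OF T] conj_ac)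
qed

theorem theorem3p2:
  fixes T :: "'a::complete_lattice \<Rightarrow> 'a \<Rightarrow> 'a"
  assumes "atomistic TYPE('a)"
    and "tnorm_on (CL :: 'a set) T"
  shows "tnorm_on (UNIV :: 'a set) (Tbar T)"
  unfolding tnorm_on_def
  using Tbar_commute[OF assms(2)] Tbar_top[OF assms] Tbar_assoc[OF assms]
  by (auto intro: Tbar_mono)

end
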